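(* The abelian groups in the class $\mathcal{C}$ are exactly the cyclic groups of prime order; that is, a finite abelian group $G$ belongs to $\mathcal{C}$ if and only if $G$ is cyclic of prime order.
   Context: For a finite group $G$ and a subgroup $H\leq G$, the Chermak-Delgado measure of $H$ is $m_G(H)=|H|\,|C_G(H)|$, where $C_G(H)$ is the centralizer of $H$ in $G$. It is regarded as a function $m_G$ from the set $L(G)$ of all subgroups of $G$ to the positive integers. $\mathcal{C}$ denotes the class of finite groups $G$ for which the function $m_G$ takes exactly two distinct values. *)

theory Defs
  imports "HOL-Algebra.Algebra"
begin

definition centralizer :: "('a, 'b) monoid_scheme \<Rightarrow> 'a set \<Rightarrow> 'a set" where
  "centralizer G H = {g \<in> carrier G. \<forall>h\<in>H. g \<otimes>\<^bsub>G\<^esub> h = h \<otimes>\<^bsub>G\<^esub> g}"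

definition cd_measure :: "('a, 'b) monoid_scheme \<Rightarrow> 'a set \<Rightarrow> nat" where
  "cd_measure G H = card H * card (centralizer G H)"

definition in_class_C :: "('a, 'b) monoid_scheme \<Rightarrow> bool" where
  "in_class_C G \<longleftrightarrow>
     group G \<and> finite (carrier G) \<and> card (cd_measure G ` {H. subgroup H G}) = 2"

end

theory Submission
  imports Defs
begin

text \<open>
  In an abelian group every centralizer is the whole group, so \<open>m\<^sub>G(H) = |H| |G|\<close>, and the values
  of the Chermak--Delgado measure correspond one-to-one to the orders of the subgroups of \<open>G\<close>.
  Among these orders there are always \<open>1\<close> and \<open>|G|\<close>, so there are exactly two of them iff \<open>G\<close> is
  nontrivial and no subgroup has an intermediate order. By Cauchy's theorem in one direction and
  Lagrange's in the other, this happens iff \<open>|G|\<close> is prime, and a group of prime order is cyclic.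
\<close>

lemma (in comm_group) centralizer_eq_carrier:
  assumes "H \<subseteq> carrier G"
  shows "centralizer G H = carrier G"
  using assms unfolding centralizer_def by (auto intro: m_comm)

lemma (in comm_group) cd_measure_eq_card_times_order:
  assumes "subgroup H G"
  shows "cd_measure G H = card H * order G"
  using subgroup.subset[OF assms]
  by (simp add: cd_measure_def centralizer_eq_carrier order_def)

text \<open>Multiplication by the nonzero number \<open>|G|\<close> is injective, so it does not change the number of
  values.\<close>

lemma (in comm_group) card_cd_measure_values:
  assumes "finite (carrier G)"
  shows "card (cd_measure G ` {H. subgroup H G}) = card (card ` {H. subgroup H G})"
proof -
  have "order G > 0"
    using assms order_gt_0_iff_finite by blast
  then have "inj_on (\<lambda>n. n * order G) (card ` {H. subgroup H G})"
    by (auto intro: inj_onI)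
  moreover have "cd_measure G ` {H. subgroup H G} = (\<lambda>n. n * order G) ` card ` {H. subgroup H G}"
    unfolding image_image by (rule image_cong) (simp_all add: cd_measure_eq_card_times_order)
  ultimately show ?thesis
    by (simp add: card_image)
qed

text \<open>Sylow's existence theorem produces a subgroup of order \<open>p ^ a\<close> for every power of \<open>p\<close> that
  divides the group order, not only for the maximal one; Cauchy's theorem is its case \<open>a = 1\<close>.\<close>

lemma (in group) exists_subgroup_of_prime_order:
  assumes "finite (carrier G)" "Factorial_Ring.prime p" "p dvd order G"
  shows "\<exists>H. subgroup H G \<and> card H = p"
proof -
  obtain m where "order G = p ^ 1 * m"
    using assms(3) by auto
  then show ?thesis
    using sylow_thm[OF assms(2) is_group _ assms(1), of 1 m] by simp
qed

text \<open>If \<open>1\<close> and \<open>|G|\<close> are distinct and the only orders, then a prime divisor of \<open>|G|\<close>, being an order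
  by Cauchy's theorem, must be \<open>|G|\<close> itself. Conversely, Lagrange's theorem leaves a group of prime
  order no third subgroup order.\<close>

lemma (in group) two_subgroup_orders_iff_prime_order:
  assumes fin: "finite (carrier G)"
  shows "card (card ` {H. subgroup H G}) = 2 \<longleftrightarrow> Factorial_Ring.prime (order G)"
    (is "card ?orders = 2 \<longleftrightarrow> _")
proof
  have one: "1 \<in> ?orders"
    using image_eqI[of 1 card "{\<one>}"] triv_subgroup by simp
  have top: "order G \<in> ?orders"
    using image_eqI[of "order G" card "carrier G"] subgroup_self by (simp add: order_def)
  have dvd: "n dvd order G" if "n \<in> ?orders" for n
    using that by (auto simp flip: lagrange)
  show "Factorial_Ring.prime (order G)" if two: "card ?orders = 2"
  proof -
    have "order G \<noteq> 1"
    proof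
      assume "order G = 1"
      then have "?orders \<subseteq> {1}"
        using dvd by auto
      then show False
        using card_mono[of "{1}" ?orders] two by simp
    qed
    moreover have "finite ?orders"
      using two card.infinite[of ?orders] by linarith
    ultimately have orders: "?orders = {1, order G}"
      using card_subset_eq[of ?orders "{1, order G}"] one top two by simp
    obtain p where p: "Factorial_Ring.prime p" "p dvd order G"
      using prime_factor_nat[OF \<open>order G \<noteq> 1\<close>] by blast
    then have "p \<in> ?orders"
      using exists_subgroup_of_prime_order[OF fin p] by blast
    with orders p show ?thesis
      by auto
  qed
  show "card ?orders = 2" if prime: "Factorial_Ring.prime (order G)"
  proof -
    have "?orders = {1, order G}"
      using one top dvd prime by (auto simp: prime_nat_iff)
    then show ?thesis
      using prime_gt_1_nat[OF prime] by simp
  qed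
qed

text \<open>By Lagrange's theorem the order of an element divides the prime \<open>|G|\<close>, so every element other
  than the identity has order \<open>|G|\<close> and generates \<open>G\<close>.\<close>

lemma (in group) prime_order_imp_cyclic:
  assumes prime: "Factorial_Ring.prime (order G)"
  shows "cyclic_group G"
proof -
  have fin: "finite (carrier G)"
    using order_gt_0_iff_finite prime_gt_0_nat[OF prime] by simp
  have "carrier G \<noteq> {\<one>}"
    using prime_gt_1_nat[OF prime] by (auto simp: order_def)
  then obtain x where x: "x \<in> carrier G" "x \<noteq> \<one>"
    using one_closed by blast
  then have "ord x = order G"
    using prime ord_dvd_group_order[of x] ord_eq_1[of x] unfolding prime_nat_iff by blast
  then have "card (generate G {x}) = card (carrier G)"
    using x generate_pow_card by (simp add: order_def)
  then have "generate G {x} = carrier G"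
    using x by (intro card_subset_eq fin generate_incl) simp_all
  then have "carrier G = range (\<lambda>n::int. x [^] n)"
    using generate_pow[of x] x by blast
  then show ?thesis
    using x cyclic_group by blast
qed

theorem corollary2p2:
  fixes G :: "('a, 'b) monoid_scheme"
  assumes "comm_group G" and "finite (carrier G)"
  shows "in_class_C G \<longleftrightarrow> cyclic_group G \<and> Factorial_Ring.prime (order G)"
proof -
  interpret comm_group G by fact
  show ?thesis
    unfolding in_class_C_def card_cd_measure_values[OF assms(2)]
      two_subgroup_orders_iff_prime_order[OF assms(2)]
    using is_group assms(2) prime_order_imp_cyclic by blast
qed

end
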